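(* Let $(X_n,\ n\geq 0)$ be a discrete-time (time-homogeneous) Markov chain on a countable state space $S$ with 1-step transition matrix $P=(p_{ij},\ i,j\in S)$, and let $U\subseteq S$. For $n\geq 1$ let $N_n=\sum_{m=1}^n 1_{\{X_m\in U\}}$, and for $i\in S$ and $0\leq k\leq n$ let $g_i(n,k)=\Pr(N_n=k\mid X_0=i)$; also set $g_i(0,0)=1$. Let $A=(a_{ij})_{i,j\in S}$ and $B=(b_{ij})_{i,j\in S}$ be the matrices with $a_{ij}=p_{ij}$ if $j\in U$ and $a_{ij}=0$ if $j\notin U$, and $b_{ij}=p_{ij}$ if $j\notin U$ and $b_{ij}=0$ if $j\in U$ (so $P=A+B$). For $k\geq 0$ and $|t|<1$ let $G(t,k)=(G_i(t,k),\ i\in S)$ be the column vector with entries $$G_i(t,k)=\sum_{n=k}^\infty g_i(n,k)\,t^{n-k}.$$ Then, for all $k\geq 0$ and $|t|<1$, $$G(t,k)=\left[(I-Bt)^{-1}A\right]^k (I-Bt)^{-1}\boldsymbol{1},$$ where $\boldsymbol{1}$ is the column vector of $1$s indexed by $S$ and $I$ is the identity matrix on $S$.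
   Context: The initial state $X_0$ does not contribute to $N_n$. Matrices indexed by $S$ act on bounded column vectors indexed by $S$ (i.e. on $\ell^\infty(S)$), and for $|t|<1$ the inverse is $(I-Bt)^{-1}=\sum_{n=0}^\infty B^n t^n$ (which converges since $B$ is a nonnegative matrix with row sums at most $1$). *)

theory Defs
  imports "HOL-Probability.Probability"
begin

subsection \<open>Markov chains on a countable state space\<close>

(* The state space is the (countable) type 's. *)
definition transition_matrix :: "('s::countable \<Rightarrow> 's \<Rightarrow> real) \<Rightarrow> bool" where
  "transition_matrix P \<longleftrightarrow> (\<forall>i j. 0 \<le> P i j) \<and> (\<forall>i. (P i has_sum 1) UNIV)"

definition markov_chain ::
  "'w measure \<Rightarrow> (nat \<Rightarrow> 'w \<Rightarrow> 's::countable) \<Rightarrow> ('s \<Rightarrow> 's \<Rightarrow> real) \<Rightarrow> bool" where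
  "markov_chain M X P \<longleftrightarrow>
     prob_space M \<and> transition_matrix P \<and>
     (\<forall>n. X n \<in> M \<rightarrow>\<^sub>M count_space UNIV) \<and>
     (\<forall>n x j. \<P>(\<omega> in M. \<forall>m\<le>n. X m \<omega> = x m) > 0 \<longrightarrow>
        \<P>(\<omega> in M. X (Suc n) \<omega> = j \<bar> \<forall>m\<le>n. X m \<omega> = x m) = P (x n) j)"

definition visits :: "(nat \<Rightarrow> 'w \<Rightarrow> 's) \<Rightarrow> 's set \<Rightarrow> nat \<Rightarrow> 'w \<Rightarrow> nat" where
  "visits X U n \<omega> = (\<Sum>m=1..n. of_bool (X m \<omega> \<in> U))"

(* M i is a law of the chain under which X 0 = i has positive probability, so that
   conditioning on X 0 = i is meaningful for every state i. A single law charging all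
   initial states is the case of constant M; the usual family P_i with X 0 = i almost
   surely is another one. *)
definition visit_prob ::
  "('s \<Rightarrow> 'w measure) \<Rightarrow> (nat \<Rightarrow> 'w \<Rightarrow> 's) \<Rightarrow> 's set \<Rightarrow> 's \<Rightarrow> nat \<Rightarrow> nat \<Rightarrow> real" where
  "visit_prob M X U i n k = \<P>(\<omega> in M i. visits X U n \<omega> = k \<bar> X 0 \<omega> = i)"

lemma visit_prob_0_0:
  assumes "\<P>(\<omega> in M i. X 0 \<omega> = i) > 0"
  shows "visit_prob M X U i 0 0 = 1"
  using assms by (simp add: visit_prob_def visits_def cond_prob_def)

(* The scalar type 'a stands for either the reals or the complex numbers. *)
definition visit_gf ::
  "('s \<Rightarrow> 'w measure) \<Rightarrow> (nat \<Rightarrow> 'w \<Rightarrow> 's) \<Rightarrow> 's set \<Rightarrow>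
   'a::{real_normed_field,banach} \<Rightarrow> nat \<Rightarrow> 's \<Rightarrow> 'a" where
  "visit_gf M X U t k i = (\<Sum>\<^sub>\<infinity>n\<in>{k..}. of_real (visit_prob M X U i n k) * t ^ (n - k))"


subsection \<open>Matrices acting on bounded vectors\<close>

definition bounded_vecs :: "('s \<Rightarrow> 'a::real_normed_field) set" where
  "bounded_vecs = {v. bounded (range v)}"

definition mat_vec ::
  "('s \<Rightarrow> 's \<Rightarrow> 'a::{real_normed_field,banach}) \<Rightarrow> ('s \<Rightarrow> 'a) \<Rightarrow> 's \<Rightarrow> 'a" where
  "mat_vec C v i = (\<Sum>\<^sub>\<infinity>j. C i j * v j)"

(* Inverse of the operator on bounded vectors given by C. *)
definition mat_inv ::
  "('s \<Rightarrow> 's \<Rightarrow> 'a::{real_normed_field,banach}) \<Rightarrow> ('s \<Rightarrow> 'a) \<Rightarrow> 's \<Rightarrow> 'a" where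
  "mat_inv C = inv_into bounded_vecs (mat_vec C)"

definition id_mat :: "'s \<Rightarrow> 's \<Rightarrow> 'a::{real_normed_field,banach}" where
  "id_mat i j = (if i = j then 1 else 0)"

definition I_minus ::
  "('s \<Rightarrow> 's \<Rightarrow> 'a::{real_normed_field,banach}) \<Rightarrow> 'a \<Rightarrow> 's \<Rightarrow> 's \<Rightarrow> 'a" where
  "I_minus B t i j = id_mat i j - B i j * t"


subsection \<open>Invertibility of I - Bt\<close>

(* These facts justify the use of inv_into in mat_inv: I - Bt is a bijection of the
   bounded vectors and its inverse is the Neumann series. *)

context
  fixes C :: "'s \<Rightarrow> 's \<Rightarrow> 'a::{real_normed_field,banach}" and B :: "'s \<Rightarrow> 's \<Rightarrow> real"
  assumes C_def: "C = (\<lambda>i j. of_real (B i j))"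
    and B_nonneg: "\<And>i j. 0 \<le> B i j"
    and B_summable: "\<And>i. B i summable_on UNIV"
    and B_le: "\<And>i. infsum (B i) UNIV \<le> 1"
begin

lemma row_dom_summable: "(\<lambda>j. B i j * c) summable_on UNIV"
  using B_summable[of i] by (rule summable_on_cmult_left)

lemma row_abs_summable:
  assumes "\<And>j. norm (v j) \<le> c"
  shows "(\<lambda>j. C i j * v j) abs_summable_on UNIV"
proof (rule Infinite_Sum.abs_summable_on_comparison_test')
  show "(\<lambda>j. B i j * c) summable_on UNIV" by (rule row_dom_summable)
  show "norm (C i j * v j) \<le> B i j * c" for j
    using assms B_nonneg by (simp add: C_def norm_mult mult_left_mono)
qed

lemma row_summable:
  assumes "\<And>j. norm (v j) \<le> c"
  shows "(\<lambda>j. C i j * v j) summable_on UNIV"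
  using row_abs_summable[OF assms] by (rule abs_summable_summable)

lemma mat_vec_norm_le:
  assumes "\<And>j. norm (v j) \<le> c"
  shows "norm (mat_vec C v i) \<le> c"
proof -
  have c: "0 \<le> c" using assms[of i] norm_ge_zero order_trans by blast
  have "norm (mat_vec C v i) \<le> (\<Sum>\<^sub>\<infinity>j. norm (C i j * v j))"
    unfolding mat_vec_def by (rule norm_infsum_bound[OF row_abs_summable[OF assms]])
  also have "\<dots> \<le> (\<Sum>\<^sub>\<infinity>j. B i j * c)"
    using row_abs_summable[OF assms] row_dom_summable
  proof (rule infsum_mono)
    show "norm (C i j * v j) \<le> B i j * c" for j
      using assms B_nonneg by (simp add: C_def norm_mult mult_left_mono)
  qed
  also have "\<dots> = infsum (B i) UNIV * c"
    by (rule infsum_cmult_left[OF B_summable])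
  also have "\<dots> \<le> c" using B_le[of i] c by (simp add: mult_left_le_one_le infsum_nonneg B_nonneg)
  finally show ?thesis .
qed

lemma mat_vec_add_scaled:
  assumes "\<And>j. norm (v j) \<le> c" "\<And>j. norm (w j) \<le> d"
  shows "mat_vec C (\<lambda>j. v j + s * w j) i = mat_vec C v i + s * mat_vec C w i"
proof -
  have "mat_vec C (\<lambda>j. v j + s * w j) i = (\<Sum>\<^sub>\<infinity>j. C i j * v j + s * (C i j * w j))"
    unfolding mat_vec_def by (rule infsum_cong) (simp add: algebra_simps)
  also have "\<dots> = (\<Sum>\<^sub>\<infinity>j. C i j * v j) + (\<Sum>\<^sub>\<infinity>j. s * (C i j * w j))"
    by (intro infsum_add summable_on_cmult_right row_summable[OF assms(1)] row_summable[OF assms(2)])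
  also have "(\<Sum>\<^sub>\<infinity>j. s * (C i j * w j)) = s * (\<Sum>\<^sub>\<infinity>j. C i j * w j)"
    by (intro infsum_cmult_right row_summable[OF assms(2)])
  finally show ?thesis by (simp add: mat_vec_def)
qed

lemma mat_vec_I_minus:
  assumes "\<And>j. norm (v j) \<le> c"
  shows "mat_vec (I_minus C t) v i = v i - t * mat_vec C v i"
proof -
  have id: "((\<lambda>j. id_mat i j * v j) has_sum v i) UNIV"
    by (rule has_sum_finiteI[of "{i}", THEN has_sum_cong_neutral[THEN iffD1, rotated 3]])
       (auto simp: id_mat_def)
  have s: "((\<lambda>j. (- t) * (C i j * v j)) has_sum (- t) * mat_vec C v i) UNIV"
    unfolding mat_vec_def by (intro has_sum_cmult_right has_sum_infsum row_summable[OF assms])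
  have "((\<lambda>j. I_minus C t i j * v j) has_sum (v i + (- t) * mat_vec C v i)) UNIV"
    using has_sum_add[OF id s] by (simp add: I_minus_def algebra_simps)
  then show ?thesis unfolding mat_vec_def[of "I_minus C t"] by (simp add: infsumI)
qed

lemma bounded_vecsE:
  assumes "v \<in> bounded_vecs"
  shows "\<exists>c. \<forall>j. norm (v j) \<le> c"
  using assms unfolding bounded_vecs_def by (auto simp: bounded_iff)

lemma bounded_vecsI: "(\<And>j. norm (v j) \<le> c) \<Longrightarrow> v \<in> bounded_vecs"
  unfolding bounded_vecs_def by (auto simp: bounded_iff)

lemma mat_vec_pow_norm_le:
  assumes "\<And>j. norm (v j) \<le> c"
  shows "norm ((mat_vec C ^^ n) v i) \<le> c"
proof (induction n arbitrary: i)
  case (Suc n)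
  then show ?case using mat_vec_norm_le[of "(mat_vec C ^^ n) v"] by simp
qed (use assms in simp)

lemma I_minus_inj:
  assumes t: "norm t < 1"
  shows "inj_on (mat_vec (I_minus C t)) bounded_vecs"
proof (rule inj_onI)
  fix v w :: "'s \<Rightarrow> 'a"
  assume "v \<in> bounded_vecs" "w \<in> bounded_vecs"
    and eq: "mat_vec (I_minus C t) v = mat_vec (I_minus C t) w"
  then obtain c d where c: "\<And>j. norm (v j) \<le> c" and d: "\<And>j. norm (w j) \<le> d"
    by (meson bounded_vecsE)
  define u where "u = (\<lambda>j. v j + (- 1) * w j)"
  have u: "u i = t * mat_vec C u i" for i
  proof -
    have m: "mat_vec C u i = mat_vec C v i - mat_vec C w i"
      using mat_vec_add_scaled[of v c w d "- 1" i, OF c d] by (simp add: u_def)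
    have "u i = v i - w i" by (simp add: u_def)
    also have "\<dots> = t * (mat_vec C v i - mat_vec C w i)"
      using fun_cong[OF eq, of i] mat_vec_I_minus[of v c t i, OF c]
        mat_vec_I_minus[of w d t i, OF d]
      by (simp add: algebra_simps)
    finally show ?thesis by (simp only: m)
  qed
  have bnd: "norm (u i) \<le> norm t ^ n * (c + d)" for n i
  proof (induction n arbitrary: i)
    case 0
    show ?case using c[of i] d[of i] norm_triangle_ineq4[of "v i" "w i"] by (simp add: u_def)
  next
    case (Suc n)
    have "norm (u i) = norm t * norm (mat_vec C u i)" by (subst u) (simp add: norm_mult)
    also have "\<dots> \<le> norm t * (norm t ^ n * (c + d))"
      by (intro mult_left_mono mat_vec_norm_le Suc) simp
    finally show ?case by (simp add: mult.assoc)
  qed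
  have "u i = 0" for i
  proof -
    have "(\<lambda>n. norm t ^ n * (c + d)) \<longlonglongrightarrow> 0"
      using t by (intro tendsto_mult_left_zero LIMSEQ_power_zero) simp
    then have "norm (u i) \<le> 0" by (rule LIMSEQ_le_const) (use bnd in blast)
    then show ?thesis by simp
  qed
  then show "v = w" by (auto simp: u_def fun_eq_iff)
qed

lemma neumann_solves:
  assumes t: "norm t < 1" and c: "\<And>j. norm (v j) \<le> c"
  defines "w \<equiv> (\<lambda>i. \<Sum>n. t ^ n * (mat_vec C ^^ n) v i)"
  shows "w \<in> bounded_vecs" and "mat_vec (I_minus C t) w = v"
proof -
  let ?a = "\<lambda>n i. t ^ n * (mat_vec C ^^ n) v i"
  have a: "norm (?a n i) \<le> norm t ^ n * c" for n i
    by (simp add: norm_mult norm_power mult_left_mono mat_vec_pow_norm_le[OF c])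
  have gs: "summable (\<lambda>n. norm t ^ n * c)"
    using t by (intro summable_mult2 summable_geometric) simp
  have sa: "summable (\<lambda>n. ?a n i)" for i
    by (rule summable_comparison_test'[OF gs, of 0]) (use a in simp)
  define K where "K = (\<Sum>n. norm t ^ n * c)"
  define p where "p = (\<lambda>N i. \<Sum>n<N. ?a n i)"
  have pw: "(\<lambda>N. p N i) \<longlonglongrightarrow> w i" for i
    using summable_LIMSEQ[OF sa] by (simp add: p_def w_def)
  have rem: "norm (w i - p N i) \<le> norm t ^ N * K" for N i
  proof -
    have eq: "w i - p N i = (\<Sum>n. ?a (n + N) i)"
      using suminf_minus_initial_segment[OF sa] by (simp add: w_def p_def)
    have gsN: "summable (\<lambda>n. norm t ^ N * (norm t ^ n * c))"
      by (intro summable_mult gs)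
    have aN: "norm (?a (n + N) i) \<le> norm t ^ N * (norm t ^ n * c)" for n
      using a[of "n + N" i] by (simp add: power_add mult_ac)
    have "norm (w i - p N i) \<le> (\<Sum>n. norm t ^ N * (norm t ^ n * c))"
      unfolding eq by (rule norm_suminf_le) (use gsN aN in auto)
    also have "\<dots> = norm t ^ N * K" unfolding K_def by (rule suminf_mult[OF gs])
    finally show ?thesis .
  qed
  have wb: "norm (w i) \<le> K" for i using rem[of i 0] by (simp add: p_def)
  then show "w \<in> bounded_vecs" by (rule bounded_vecsI)
  have pb: "norm (p N i) \<le> norm t ^ N * K + K" for N i
    using norm_triangle_ineq4[of "w i" "w i - p N i"] rem[of i N] wb[of i] by simp
  have Bp: "t * mat_vec C (p N) i = p (Suc N) i - v i" for N i
  proof (induction N)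
    case 0
    show ?case by (simp add: p_def mat_vec_def)
  next
    case (Suc N)
    have "p (Suc N) = (\<lambda>j. p N j + t ^ N * (mat_vec C ^^ N) v j)" by (simp add: p_def fun_eq_iff)
    then have "mat_vec C (p (Suc N)) i = mat_vec C (p N) i + t ^ N * (mat_vec C ^^ Suc N) v i"
      using mat_vec_add_scaled[of "p N", OF pb mat_vec_pow_norm_le[OF c]] by simp
    then have "t * mat_vec C (p (Suc N)) i = p (Suc N) i - v i + ?a (Suc N) i"
      using Suc by (simp add: algebra_simps)
    also have "\<dots> = p (Suc (Suc N)) i - v i" by (simp add: p_def)
    finally show ?case .
  qed
  have "t * mat_vec C w i = w i - v i" for i
  proof -
    have "(\<lambda>N. p (Suc N) i - v i) \<longlonglongrightarrow> w i - v i"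
      by (rule tendsto_diff[OF LIMSEQ_Suc[OF pw] tendsto_const])
    moreover have "(\<lambda>N. p (Suc N) i - v i) \<longlonglongrightarrow> t * mat_vec C w i"
    proof -
      have diff: "norm (mat_vec C (p N) i - mat_vec C w i) \<le> norm t ^ N * K" for N
      proof -
        have "mat_vec C (\<lambda>j. p N j + (- 1) * w j) i = mat_vec C (p N) i + (- 1) * mat_vec C w i"
          by (rule mat_vec_add_scaled[OF pb wb])
        moreover have "norm (mat_vec C (\<lambda>j. p N j + (- 1) * w j) i) \<le> norm t ^ N * K"
          by (rule mat_vec_norm_le) (use rem[of _ N] in \<open>simp add: norm_minus_commute\<close>)
        ultimately show ?thesis by simp
      qed
      have "(\<lambda>N. norm t ^ N * K) \<longlonglongrightarrow> 0"
        using t by (intro tendsto_mult_left_zero LIMSEQ_power_zero) simp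
      then have "(\<lambda>N. mat_vec C (p N) i - mat_vec C w i) \<longlonglongrightarrow> 0"
        by (rule Lim_null_comparison[rotated]) (simp add: diff)
      then have "(\<lambda>N. mat_vec C (p N) i) \<longlonglongrightarrow> mat_vec C w i" by (simp add: LIM_zero_iff)
      then have "(\<lambda>N. t * mat_vec C (p N) i) \<longlonglongrightarrow> t * mat_vec C w i" by (rule tendsto_mult_left)
      then show ?thesis by (simp add: Bp)
    qed
    ultimately show ?thesis by (rule LIMSEQ_unique[symmetric])
  qed
  then show "mat_vec (I_minus C t) w = v"
    using mat_vec_I_minus[OF wb] by (simp add: fun_eq_iff)
qed

lemma I_minus_bij:
  assumes t: "norm t < 1"
  shows "bij_betw (mat_vec (I_minus C t)) bounded_vecs bounded_vecs"
  unfolding bij_betw_def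
proof (intro conjI I_minus_inj[OF t] set_eqI iffI)
  fix v :: "'s \<Rightarrow> 'a"
  assume "v \<in> mat_vec (I_minus C t) ` bounded_vecs"
  then obtain u where u: "u \<in> bounded_vecs" "v = mat_vec (I_minus C t) u" by blast
  then obtain c where c: "\<And>j. norm (u j) \<le> c" by (meson bounded_vecsE)
  have "norm (v i) \<le> c + norm t * c" for i
    using norm_triangle_ineq4[of "u i" "t * mat_vec C u i"] c[of i]
      mult_left_mono[OF mat_vec_norm_le[of u c i, OF c] norm_ge_zero[of t]]
    by (simp add: u(2) mat_vec_I_minus[of u c, OF c] norm_mult)
  then show "v \<in> bounded_vecs" by (rule bounded_vecsI)
next
  fix v :: "'s \<Rightarrow> 'a"
  assume "v \<in> bounded_vecs"
  then obtain c where c: "\<And>j. norm (v j) \<le> c" by (meson bounded_vecsE)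
  show "v \<in> mat_vec (I_minus C t) ` bounded_vecs"
    using imageI[OF neumann_solves(1)[of t v c, OF t c], of "mat_vec (I_minus C t)"]
    by (simp only: neumann_solves(2)[of t v c, OF t c])
qed

lemma mat_inv_neumann:
  assumes t: "norm t < 1" and v: "v \<in> bounded_vecs"
  shows "mat_inv (I_minus C t) v i = (\<Sum>n. t ^ n * (mat_vec C ^^ n) v i)"
proof -
  obtain c where c: "\<And>j. norm (v j) \<le> c" using v by (meson bounded_vecsE)
  from neumann_solves[of t v c, OF t c] I_minus_inj[OF t] show ?thesis
    unfolding mat_inv_def by (simp add: inv_into_f_eq)
qed

end

lemma
  fixes B :: "'s::countable \<Rightarrow> 's \<Rightarrow> 'a::{real_normed_field,banach}"
  assumes P: "transition_matrix P"
    and B: "\<And>i j. B i j = (if j \<notin> U then of_real (P i j) else 0)"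
    and t: "norm t < 1"
  shows I_minus_Bt_bij: "bij_betw (mat_vec (I_minus B t)) bounded_vecs bounded_vecs"
    and I_minus_Bt_neumann: "v \<in> bounded_vecs \<Longrightarrow>
      mat_inv (I_minus B t) v i = (\<Sum>n. t ^ n * (mat_vec B ^^ n) v i)"
proof -
  define Q where "Q = (\<lambda>i j. if j \<notin> U then P i j else 0)"
  have BQ: "B = (\<lambda>i j. of_real (Q i j))" by (auto simp: B Q_def fun_eq_iff)
  have Q0: "0 \<le> Q i j" and QP: "Q i j \<le> P i j" for i j
    using P by (auto simp: Q_def transition_matrix_def)
  have hs: "(P i has_sum 1) UNIV" for i using P by (simp add: transition_matrix_def)
  have Ps: "P i summable_on UNIV" and P1: "infsum (P i) UNIV = 1" for i
    using has_sum_imp_summable[OF hs] infsumI[OF hs] by blast+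
  have Qs: "Q i summable_on UNIV" for i
    by (rule summable_on_comparison_test[OF Ps]) (use Q0 QP in auto)
  have Q1: "infsum (Q i) UNIV \<le> 1" for i
    unfolding P1[of i, symmetric] by (rule infsum_mono[OF Qs Ps]) (rule QP)
  show "bij_betw (mat_vec (I_minus B t)) bounded_vecs bounded_vecs"
    by (rule I_minus_bij[OF BQ Q0 Qs Q1 t])
  show "mat_inv (I_minus B t) v i = (\<Sum>n. t ^ n * (mat_vec B ^^ n) v i)"
    if "v \<in> bounded_vecs"
    by (rule mat_inv_neumann[OF BQ Q0 Qs Q1 t that])
qed

end

theory Submission
  imports Defs
begin

text \<open>
  Let \<open>g n k i\<close> be the law of the number of visits in \<open>n\<close> steps from \<open>i\<close>. Conditioning on the
  first step gives \<open>g (n+1) k = A (g n (k-1)) + B (g n k)\<close>, where the first term is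
  absent for \<open>k = 0\<close>. Multiplying by powers of \<open>t\<close> and summing, \<open>(I - Bt) G 0 = 1\<close> and
  \<open>(I - Bt) G (k+1) = A (G k)\<close>; each \<open>G k\<close> is bounded, so bijectivity of \<open>I - Bt\<close> on bounded
  vectors finishes the proof.
\<close>

subsection \<open>Substochastic matrices\<close>

text \<open>What the operator lemmas such as \<open>mat_vec_norm_le\<close> require of a real
  matrix, bundled so that it applies at once to \<open>P\<close> and to its restrictions to the
  columns in \<open>U\<close> and \<open>- U\<close>.\<close>

definition substochastic :: "('s \<Rightarrow> 's \<Rightarrow> real) \<Rightarrow> bool" where
  "substochastic Q \<longleftrightarrow>
     (\<forall>i j. 0 \<le> Q i j) \<and> (\<forall>i. Q i summable_on UNIV) \<and> (\<forall>i. infsum (Q i) UNIV \<le> 1)"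

lemma transition_matrix_substochastic:
  assumes "transition_matrix P"
  shows "substochastic P"
  using assms by (auto simp: transition_matrix_def substochastic_def has_sum_iff)

lemma substochastic_restrict_columns:
  assumes "substochastic P"
  shows "substochastic (\<lambda>i j. if j \<in> V then P i j else 0)"
proof -
  have P: "0 \<le> P i j" "P i summable_on UNIV" "infsum (P i) UNIV \<le> 1" for i j
    using assms by (auto simp: substochastic_def)
  have s: "(\<lambda>j. if j \<in> V then P i j else 0) summable_on UNIV" for i
    by (rule summable_on_comparison_test[OF P(2)[of i]]) (auto simp: P)
  have "infsum (\<lambda>j. if j \<in> V then P i j else 0) UNIV \<le> infsum (P i) UNIV" for i
    by (rule infsum_mono[OF s P(2)]) (auto simp: P)
  then show ?thesis
    using P s order_trans by (fastforce simp: substochastic_def)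
qed

section \<open>Rearranging infinite sums\<close>

lemma infsum_nat_split:
  fixes f :: "nat \<Rightarrow> 'a::banach"
  assumes "f summable_on UNIV"
  shows "infsum f UNIV = f 0 + (\<Sum>\<^sub>\<infinity>n. f (Suc n))"
proof -
  have s: "f summable_on A" for A
    using summable_on_subset_banach[OF assms] by blast
  have "infsum f ({0} \<union> range Suc) = infsum f {0} + infsum f (range Suc)"
    by (rule infsum_Un_disjoint[OF s s]) auto
  moreover have "{0} \<union> range Suc = UNIV"
    by (metis UNIV_nat_eq insert_is_Un)
  ultimately show ?thesis
    by (simp add: infsum_reindex o_def)
qed

text \<open>Fubini: row \<open>i\<close> of the double family is dominated by
  \<open>Q i j * c n\<close>, which is summable over all pairs because the row of \<open>Q\<close>
  and the bounds \<open>c\<close> are summable. Later \<open>c\<close> is a geometric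
  series.\<close>

lemma mat_vec_infsum:
  fixes C :: "'s \<Rightarrow> 's \<Rightarrow> 'a::{real_normed_field,banach}" and f :: "'b \<Rightarrow> 's \<Rightarrow> 'a"
  assumes Q: "substochastic Q" and C: "C = (\<lambda>i j. of_real (Q i j))"
    and f: "\<And>n j. norm (f n j) \<le> c n" and c: "c summable_on UNIV"
  shows "mat_vec C (\<lambda>j. \<Sum>\<^sub>\<infinity>n. f n j) i = (\<Sum>\<^sub>\<infinity>n. mat_vec C (f n) i)"
proof -
  have Q0: "0 \<le> Q i j" and Qs: "Q i summable_on UNIV" for i j
    using Q by (auto simp: substochastic_def)
  have c0: "0 \<le> c n" for n
    using f[of n undefined] norm_ge_zero order_trans by blast
  have "(\<lambda>p. Q i (fst p) * c (snd p)) summable_on UNIV \<times> UNIV"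
  proof (rule summable_on_SigmaI)
    show "((\<lambda>n. Q i (fst (j, n)) * c (snd (j, n))) has_sum Q i j * infsum c UNIV) UNIV" for j
      using has_sum_cmult_right[OF has_sum_infsum[OF c]] by simp
    show "(\<lambda>j. Q i j * infsum c UNIV) summable_on UNIV"
      by (rule summable_on_cmult_left[OF Qs])
  qed (auto simp: Q0 c0)
  then have "(\<lambda>(j, n). C i j * f n j) abs_summable_on UNIV \<times> UNIV"
    by (rule Infinite_Sum.abs_summable_on_comparison_test')
       (auto simp: C norm_mult Q0 f intro!: mult_left_mono)
  then have sw: "(\<lambda>(j, n). C i j * f n j) summable_on UNIV \<times> UNIV"
    by (rule abs_summable_summable)
  have fs: "(\<lambda>n. f n j) summable_on UNIV" for j
    by (rule abs_summable_summable, rule Infinite_Sum.abs_summable_on_comparison_test'[OF c])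
       (rule f)
  have "mat_vec C (\<lambda>j. \<Sum>\<^sub>\<infinity>n. f n j) i = (\<Sum>\<^sub>\<infinity>j. \<Sum>\<^sub>\<infinity>n. C i j * f n j)"
    unfolding mat_vec_def by (intro infsum_cong infsum_cmult_right[symmetric] fs)
  also have "\<dots> = (\<Sum>\<^sub>\<infinity>n. mat_vec C (f n) i)"
    unfolding mat_vec_def by (rule infsum_swap_banach[OF sw])
  finally show ?thesis .
qed

subsection \<open>The law of the number of visits\<close>

text \<open>First-step recursion stated in terms of \<open>P\<close> alone, so that the analysis
  needs no probability space. The guard \<open>k = 0\<close> matters because \<open>k - 1\<close>
  truncates to 0 on the naturals.\<close>

primrec visit_dist :: "('s \<Rightarrow> 's \<Rightarrow> real) \<Rightarrow> 's set \<Rightarrow> nat \<Rightarrow> nat \<Rightarrow> 's \<Rightarrow> real" where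
  "visit_dist P U 0 k i = of_bool (k = 0)"
| "visit_dist P U (Suc n) k i =
     (\<Sum>\<^sub>\<infinity>j. P i j * (if j \<in> U then (if k = 0 then 0 else visit_dist P U n (k - 1) j)
                        else visit_dist P U n k j))"

text \<open>Each step of the recursion applies \<open>P\<close> to a vector bounded by 1, and a
  substochastic matrix preserves that bound.\<close>

lemma norm_visit_dist_le_1:
  assumes P: "substochastic P"
  shows "norm (visit_dist P U n k i) \<le> 1"
proof (induction n arbitrary: k i)
  case (Suc n)
  let ?v = "\<lambda>j. if j \<in> U then (if k = 0 then 0 else visit_dist P U n (k - 1) j)
    else visit_dist P U n k j"
  have "norm (mat_vec P ?v i) \<le> 1"
    by (rule mat_vec_norm_le[of P P]) (use P Suc in \<open>auto simp: substochastic_def fun_eq_iff\<close>)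
  then show ?case by (simp add: mat_vec_def)
qed simp

lemma visit_dist_eq_0: "n < k \<Longrightarrow> visit_dist P U n k i = 0"
proof (induction n arbitrary: k i)
  case (Suc n)
  then have "visit_dist P U n (k - 1) j = 0" "visit_dist P U n k j = 0" for j
    by auto
  then show ?case by (simp cong: if_cong)
qed simp

text \<open>Splitting the row sum according to whether the first step lands in \<open>U\<close>
  separates the \<open>A\<close> part from the \<open>B\<close> part. Both parts are summable, so
  \<open>of_real\<close> passes through the sums.\<close>

lemma visit_dist_Suc_of_real:
  fixes A B :: "'s \<Rightarrow> 's \<Rightarrow> 'a::{real_normed_field,banach}"
  assumes P: "substochastic P"
    and A: "\<And>i j. A i j = (if j \<in> U then of_real (P i j) else 0)"
    and B: "\<And>i j. B i j = (if j \<notin> U then of_real (P i j) else 0)"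
  shows "of_real (visit_dist P U (Suc n) k i) =
    (if k = 0 then 0 else mat_vec A (\<lambda>j. of_real (visit_dist P U n (k - 1) j)) i)
    + mat_vec B (\<lambda>j. of_real (visit_dist P U n k j)) i"
proof -
  let ?g = "visit_dist P U n"
  have sub: "(\<lambda>j. (if j \<in> V then P i j else 0) * ?g l j) summable_on UNIV" for V l
  proof -
    have "substochastic (\<lambda>i j. if j \<in> V then P i j else 0)"
      by (rule substochastic_restrict_columns[OF P])
    then show ?thesis
      by (intro row_summable[where C = "\<lambda>i j. if j \<in> V then P i j else 0"
          and B = "\<lambda>i j. if j \<in> V then P i j else 0" and c = 1])
         (auto simp: substochastic_def norm_visit_dist_le_1[OF P, unfolded real_norm_def])
  qed
  let ?a = "\<lambda>j. if k = 0 then 0 else (if j \<in> U then P i j else 0) * ?g (k - 1) j"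
  let ?b = "\<lambda>j. (if j \<in> - U then P i j else 0) * ?g k j"
  have a: "?a summable_on UNIV"
    using sub[of U "k - 1"] by (cases "k = 0") simp_all
  have "visit_dist P U (Suc n) k i = (\<Sum>\<^sub>\<infinity>j. ?a j + ?b j)"
    by (auto intro!: infsum_cong)
  also have "\<dots> = infsum ?a UNIV + infsum ?b UNIV"
    by (rule infsum_add[OF a sub])
  finally have "(of_real (visit_dist P U (Suc n) k i) :: 'a) =
      of_real (infsum ?a UNIV) + of_real (infsum ?b UNIV)"
    by simp
  also have "(of_real (infsum ?a UNIV) :: 'a) = (\<Sum>\<^sub>\<infinity>j. of_real (?a j))"
    by (rule infsumI[symmetric], rule has_sum_of_real[OF has_sum_infsum[OF a]])
  also have "(of_real (infsum ?b UNIV) :: 'a) = (\<Sum>\<^sub>\<infinity>j. of_real (?b j))"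
    by (rule infsumI[symmetric], rule has_sum_of_real[OF has_sum_infsum[OF sub]])
  finally show ?thesis
    by (auto simp: mat_vec_def A B intro!: arg_cong2[where f = "(+)"] infsum_cong)
qed

subsection \<open>Path probabilities\<close>

text \<open>Countable additivity over the fibres of \<open>Y\<close>, indexed first by
  \<open>to_nat\<close> codes; codes of no state give empty fibres and drop out.\<close>

lemma (in prob_space) prob_has_sum_countable:
  fixes Y :: "'a \<Rightarrow> 's::countable"
  assumes Y: "Y \<in> M \<rightarrow>\<^sub>M count_space UNIV" and E: "E \<in> sets M"
  shows "((\<lambda>j. prob {\<omega>\<in>E. Y \<omega> = j}) has_sum prob E) UNIV"
proof -
  define F where "F n = {\<omega>\<in>E. to_nat (Y \<omega>) = n}" for n
  have E_eq: "E \<inter> space M = E"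
    using sets.sets_into_space[OF E] by blast
  have [measurable]: "E \<in> sets M" "Y \<in> M \<rightarrow>\<^sub>M count_space UNIV" by fact+
  have F: "F n \<in> sets M" for n
  proof -
    have "F n = E \<inter> (Y -` {j. to_nat j = n} \<inter> space M)"
      using E_eq unfolding F_def by blast
    then show ?thesis by simp
  qed
  have "(\<lambda>n. prob (F n)) sums prob (\<Union>n. F n)"
    by (rule finite_measure_UNION) (use F in \<open>auto simp: disjoint_family_on_def F_def\<close>)
  moreover have "(\<Union>n. F n) = E" by (auto simp: F_def)
  ultimately have "((\<lambda>n. prob (F n)) has_sum prob E) UNIV"
    by (intro sums_nonneg_imp_has_sum) auto
  moreover have "prob (F n) = 0" if "n \<notin> range (to_nat :: 's \<Rightarrow> nat)" for n
  proof -
    have "F n = {}" using that by (auto simp: F_def)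
    then show ?thesis by simp
  qed
  ultimately have "((\<lambda>n. prob (F n)) has_sum prob E) (range (to_nat :: 's \<Rightarrow> nat))"
    by (subst (asm) has_sum_cong_neutral[where T = "range (to_nat :: 's \<Rightarrow> nat)"]) auto
  then show ?thesis
    by (simp add: has_sum_reindex[OF inj_to_nat] F_def o_def)
qed

text \<open>As \<open>visits\<close> ignores time 0, shifting the process by one step loses exactly
  the visit at time 1.\<close>

lemma visits_Suc:
  "visits X U (Suc n) \<omega> = of_bool (X 1 \<omega> \<in> U) + visits (\<lambda>m. X (Suc m)) U n \<omega>"
proof -
  have "visits X U (Suc n) \<omega> = of_bool (X 1 \<omega> \<in> U) + (\<Sum>m=Suc 1..Suc n. of_bool (X m \<omega> \<in> U))"
    unfolding visits_def by (subst sum.atLeast_Suc_atMost) simp_all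
  also have "(\<Sum>m=Suc 1..Suc n. of_bool (X m \<omega> \<in> U)) = visits (\<lambda>m. X (Suc m)) U n \<omega>"
    unfolding visits_def by (rule sum.shift_bounds_cl_Suc_ivl)
  finally show ?thesis .
qed

lemma measurable_visits:
  assumes [measurable]: "\<And>m. X m \<in> M \<rightarrow>\<^sub>M count_space UNIV"
  shows "visits X U n \<in> M \<rightarrow>\<^sub>M count_space UNIV"
proof -
  have [measurable]: "Measurable.pred M (\<lambda>\<omega>. X m \<omega> \<in> U)" for m
    by (rule measurable_compose[OF assms]) simp
  show ?thesis unfolding visits_def by measurable
qed

text \<open>The product form of the Markov property holds for null paths too, since both sides are
  then 0; no positivity condition has to be carried along.\<close>

lemma prob_path_step:
  assumes chain: "markov_chain M X P"
  shows "\<P>(\<omega> in M. (\<forall>l\<le>m. X l \<omega> = x l) \<and> X (Suc m) \<omega> = j) =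
    \<P>(\<omega> in M. \<forall>l\<le>m. X l \<omega> = x l) * P (x m) j"
proof -
  interpret prob_space M using chain by (simp add: markov_chain_def)
  have [measurable]: "X l \<in> M \<rightarrow>\<^sub>M count_space UNIV" for l
    using chain by (simp add: markov_chain_def)
  show ?thesis
  proof (cases "\<P>(\<omega> in M. \<forall>l\<le>m. X l \<omega> = x l) = 0")
    case True
    have "\<P>(\<omega> in M. (\<forall>l\<le>m. X l \<omega> = x l) \<and> X (Suc m) \<omega> = j) \<le>
        \<P>(\<omega> in M. \<forall>l\<le>m. X l \<omega> = x l)"
      by (rule finite_measure_mono) auto
    then show ?thesis using True by (simp add: antisym)
  next
    case False
    then have pos: "\<P>(\<omega> in M. \<forall>l\<le>m. X l \<omega> = x l) > 0"
      by (simp add: zero_less_measure_iff)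
    then have "\<P>(\<omega> in M. X (Suc m) \<omega> = j \<bar> \<forall>l\<le>m. X l \<omega> = x l) = P (x m) j"
      using chain by (simp add: markov_chain_def)
    then show ?thesis
      using pos by (simp add: cond_prob_def field_simps conj_commute)
  qed
qed

text \<open>The Markov property is given relative to whole paths, so the induction on
  \<open>n\<close> keeps the past path arbitrary: conditioning on the next state only extends that
  path by one.\<close>

lemma prob_path_visits:
  assumes chain: "markov_chain M X P"
  shows "\<P>(\<omega> in M. (\<forall>l\<le>m. X l \<omega> = x l) \<and> visits (\<lambda>l. X (m + l)) U n \<omega> = k) =
    \<P>(\<omega> in M. \<forall>l\<le>m. X l \<omega> = x l) * visit_dist P U n k (x m)"
proof (induction n arbitrary: m x k)
  case 0
  show ?case by (cases "k = 0") (simp_all add: visits_def)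
next
  case (Suc n)
  interpret prob_space M using chain by (simp add: markov_chain_def)
  have X[measurable]: "X l \<in> M \<rightarrow>\<^sub>M count_space UNIV" for l
    using chain by (simp add: markov_chain_def)
  have V[measurable]: "visits (\<lambda>l. X (m + l)) U n \<in> M \<rightarrow>\<^sub>M count_space UNIV" for m n
    by (rule measurable_visits) measurable
  let ?path = "\<lambda>\<omega>. \<forall>l\<le>m. X l \<omega> = x l"
  let ?E = "{\<omega>\<in>space M. ?path \<omega> \<and> visits (\<lambda>l. X (m + l)) U (Suc n) \<omega> = k}"
  let ?v = "\<lambda>j. if j \<in> U then (if k = 0 then 0 else visit_dist P U n (k - 1) j)
    else visit_dist P U n k j"
  have step: "prob {\<omega>\<in>?E. X (Suc m) \<omega> = j} = \<P>(\<omega> in M. ?path \<omega>) * (P (x m) j * ?v j)" for j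
  proof -
    let ?y = "x(Suc m := j)"
    have path: "(\<forall>l\<le>Suc m. X l \<omega> = ?y l) \<longleftrightarrow> ?path \<omega> \<and> X (Suc m) \<omega> = j" for \<omega>
      by (auto simp: le_Suc_eq)
    have vis: "visits (\<lambda>l. X (m + l)) U (Suc n) \<omega> =
        of_bool (X (Suc m) \<omega> \<in> U) + visits (\<lambda>l. X (Suc m + l)) U n \<omega>" for \<omega>
      by (simp add: visits_Suc)
    have IH: "\<P>(\<omega> in M. (?path \<omega> \<and> X (Suc m) \<omega> = j) \<and> visits (\<lambda>l. X (Suc m + l)) U n \<omega> = k') =
        \<P>(\<omega> in M. ?path \<omega>) * P (x m) j * visit_dist P U n k' j" for k'
      using Suc.IH[of "Suc m" ?y k'] by (simp only: path prob_path_step[OF chain] fun_upd_same)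
    \<comment> \<open>A next state in \<open>U\<close> uses up one of the \<open>k\<close> visits,
      which is impossible for \<open>k = 0\<close>; a state outside \<open>U\<close> leaves all
      \<open>k\<close> to the remaining \<open>n\<close> steps.\<close>
    consider "j \<in> U" "k = 0" | k' where "j \<in> U" "k = Suc k'" | "j \<notin> U"
      by (cases k) auto
    then show ?thesis
    proof cases
      case 1
      then have "{\<omega>\<in>?E. X (Suc m) \<omega> = j} = {}"
        by (auto simp: vis)
      then show ?thesis using 1 by (simp only:) simp
    next
      case 2
      then have "{\<omega>\<in>?E. X (Suc m) \<omega> = j} =
          {\<omega>\<in>space M. (?path \<omega> \<and> X (Suc m) \<omega> = j) \<and> visits (\<lambda>l. X (Suc m + l)) U n \<omega> = k'}"
        by (auto simp: vis)
      then show ?thesis using 2 by (simp only: IH) simp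
    next
      case 3
      then have "{\<omega>\<in>?E. X (Suc m) \<omega> = j} =
          {\<omega>\<in>space M. (?path \<omega> \<and> X (Suc m) \<omega> = j) \<and> visits (\<lambda>l. X (Suc m + l)) U n \<omega> = k}"
        by (auto simp: vis)
      then show ?thesis using 3 by (simp only: IH) simp
    qed
  qed
  have "?E \<in> sets M" by measurable
  from prob_has_sum_countable[OF X[of "Suc m"] this]
  have "prob ?E = (\<Sum>\<^sub>\<infinity>j. \<P>(\<omega> in M. ?path \<omega>) * (P (x m) j * ?v j))"
    by (simp only: step infsumI)
  also have "\<dots> = \<P>(\<omega> in M. ?path \<omega>) * (\<Sum>\<^sub>\<infinity>j. P (x m) j * ?v j)"
    by (rule infsum_cmult_right')
  finally show ?case by simp
qed

text \<open>The past path consists of \<open>X 0\<close> alone, and the positive probability of the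
  initial state cancels against the denominator.\<close>

lemma visit_prob_eq_visit_dist:
  assumes "markov_chain (M i) X P" and "\<P>(\<omega> in M i. X 0 \<omega> = i) > 0"
  shows "visit_prob M X U i n k = visit_dist P U n k i"
  using prob_path_visits[OF assms(1), of 0 "\<lambda>_. i" U n k] assms(2)
  by (simp add: visit_prob_def cond_prob_def conj_commute)

subsection \<open>The generating function\<close>

text \<open>The fixed-point equation says that \<open>w\<close> is a preimage of \<open>v\<close>
  under I - Bt. Since \<open>mat_inv\<close> inverts on bounded vectors, boundedness of
  \<open>w\<close> and injectivity there identify it.\<close>

lemma mat_inv_I_minus_eqI:
  fixes B :: "'s::countable \<Rightarrow> 's \<Rightarrow> 'a::{real_normed_field,banach}"
  assumes P: "transition_matrix P"
    and B: "\<And>i j. B i j = (if j \<notin> U then of_real (P i j) else 0)"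
    and t: "norm t < 1"
    and w: "\<And>i. norm (w i) \<le> c" and eq: "\<And>i. w i = v i + t * mat_vec B w i"
  shows "mat_inv (I_minus B t) v = w"
proof -
  define Q where "Q = (\<lambda>i j. if j \<in> - U then P i j else 0)"
  have BQ: "B = (\<lambda>i j. of_real (Q i j))" by (auto simp: B Q_def fun_eq_iff)
  have Q: "substochastic Q"
    unfolding Q_def by (intro substochastic_restrict_columns transition_matrix_substochastic P)
  have "mat_vec (I_minus B t) w i = v i" for i
    using mat_vec_I_minus[where t = t and i = i, OF BQ _ _ _ w] Q eq[of i]
    by (simp add: substochastic_def)
  then have "mat_vec (I_minus B t) w = v" by auto
  moreover have "w \<in> bounded_vecs"
    using w by (auto simp: bounded_vecs_def bounded_iff)
  ultimately show ?thesis
    using I_minus_Bt_bij[OF P B t] unfolding mat_inv_def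
    by (intro inv_into_f_eq) (auto simp: bij_betw_def)
qed

section \<open>Power series in \<open>t\<close> and their linear equations\<close>

context
  fixes P :: "'s::countable \<Rightarrow> 's \<Rightarrow> real" and U :: "'s set"
    and t :: "'a::{real_normed_field,banach}"
  assumes P: "transition_matrix P" and t: "norm t < 1"
begin

text \<open>The index \<open>n\<close> is the exponent of \<open>t\<close>, so the term belongs to
  \<open>n + k\<close> steps and the series starts at 0.\<close>

definition gf_term :: "nat \<Rightarrow> nat \<Rightarrow> 's \<Rightarrow> 'a" where
  "gf_term k n i = of_real (visit_dist P U (n + k) k i) * t ^ n"

definition gf :: "nat \<Rightarrow> 's \<Rightarrow> 'a" where
  "gf k i = (\<Sum>\<^sub>\<infinity>n. gf_term k n i)"

lemma norm_gf_term_le: "norm (gf_term k n i) \<le> norm t ^ n"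
  using norm_visit_dist_le_1[OF transition_matrix_substochastic[OF P],
      where U = U and n = "n + k" and k = k and i = i]
  by (simp add: gf_term_def norm_mult norm_power mult_left_le_one_le)

lemma geometric_summable_on: "(\<lambda>n. norm t ^ n) summable_on (UNIV :: nat set)"
  by (rule norm_summable_imp_summable_on) (use t in simp)

lemma gf_term_abs_summable: "(\<lambda>n. gf_term k n i) abs_summable_on UNIV"
  by (rule Infinite_Sum.abs_summable_on_comparison_test'[OF geometric_summable_on])
     (rule norm_gf_term_le)

text \<open>The bound does not depend on \<open>i\<close>, which makes \<open>gf k\<close> a bounded
  vector.\<close>

lemma norm_gf_le: "norm (gf k i) \<le> (\<Sum>\<^sub>\<infinity>n. norm t ^ n)"
proof -
  have "norm (gf k i) \<le> (\<Sum>\<^sub>\<infinity>n. norm (gf_term k n i))"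
    unfolding gf_def by (rule norm_infsum_bound[OF gf_term_abs_summable])
  also have "\<dots> \<le> (\<Sum>\<^sub>\<infinity>n. norm t ^ n)"
    by (rule infsum_mono[OF gf_term_abs_summable geometric_summable_on]) (rule norm_gf_term_le)
  finally show ?thesis .
qed

text \<open>A first step into \<open>U\<close> lowers both the number of steps and \<open>k\<close>,
  so the exponent stays; a first step outside \<open>U\<close> lowers only the number of steps,
  which costs a factor \<open>t\<close>.\<close>

lemma gf_equation:
  assumes A: "\<And>i j. A i j = (if j \<in> U then of_real (P i j) else (0::'a))"
    and B: "\<And>i j. B i j = (if j \<notin> U then of_real (P i j) else (0::'a))"
  shows "gf k i = (if k = 0 then 1 else mat_vec A (gf (k - 1)) i) + t * mat_vec B (gf k) i"
proof -
  note sub = transition_matrix_substochastic[OF P]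
  note ms = mat_vec_infsum[OF substochastic_restrict_columns[OF sub] _ norm_gf_term_le
      geometric_summable_on]
  have scale: "mat_vec C (\<lambda>j. of_real (u j)) i * s = mat_vec C (\<lambda>j. of_real (u j) * s) i"
    for C :: "'s \<Rightarrow> 's \<Rightarrow> 'a" and u s
    by (simp add: mat_vec_def infsum_cmult_left'[symmetric] mult.assoc)
  have AG: "mat_vec A (gf l) i = (\<Sum>\<^sub>\<infinity>n. mat_vec A (gf_term l n) i)" for l
    unfolding gf_def by (rule ms[of _ U]) (auto simp: A fun_eq_iff)
  have BG: "mat_vec B (gf l) i = (\<Sum>\<^sub>\<infinity>n. mat_vec B (gf_term l n) i)" for l
    unfolding gf_def by (rule ms[of _ "- U"]) (auto simp: B fun_eq_iff)
  have As: "(\<lambda>n. mat_vec A (gf_term l n) i) abs_summable_on UNIV" for l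
  proof (rule Infinite_Sum.abs_summable_on_comparison_test'[OF geometric_summable_on])
    have "A = (\<lambda>i j. of_real (if j \<in> U then P i j else 0))"
      by (auto simp: A fun_eq_iff)
    from mat_vec_norm_le[OF this _ _ _ norm_gf_term_le]
    show "norm (mat_vec A (gf_term l n) i) \<le> norm t ^ n" for n
      using substochastic_restrict_columns[OF sub, of U] by (simp add: substochastic_def)
  qed
  \<comment> \<open>For \<open>k = 0\<close> only the zero-step term remains, and it supplies the
    constant 1.\<close>
  define a where "a n = (if k = 0 then of_bool (n = 0) else mat_vec A (gf_term (k - 1) n) i)" for n
  \<comment> \<open>At \<open>n = 0\<close> the \<open>B\<close> part would ask for \<open>k\<close>
    visits in fewer than \<open>k\<close> steps, hence the value 0.\<close>
  define b where "b n = (if n = 0 then 0 else t * mat_vec B (gf_term k (n - 1)) i)" for n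
  have summand: "gf_term k n i = a n + b n" for n
  proof (cases "n + k")
    case 0
    then show ?thesis by (simp add: gf_term_def a_def b_def)
  next
    case (Suc m)
    have "gf_term k n i =
        (if k = 0 then 0 else mat_vec A (\<lambda>j. of_real (visit_dist P U m (k - 1) j)) i) * t ^ n
        + mat_vec B (\<lambda>j. of_real (visit_dist P U m k j)) i * t ^ n"
      unfolding gf_term_def Suc visit_dist_Suc_of_real[OF sub A B] by (rule distrib_right)
    also have "(if k = 0 then 0 else mat_vec A (\<lambda>j. of_real (visit_dist P U m (k - 1) j)) i) * t ^ n
        = a n"
    proof (cases k)
      case (Suc k')
      then have "m = n + k'" using \<open>n + k = Suc m\<close> by simp
      then show ?thesis using Suc by (simp add: a_def gf_term_def[abs_def] scale)
    qed (use Suc in \<open>simp add: a_def\<close>)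
    also have "mat_vec B (\<lambda>j. of_real (visit_dist P U m k j)) i * t ^ n = b n"
    proof (cases n)
      case 0
      then show ?thesis
        using Suc by (simp add: b_def visit_dist_eq_0 mat_vec_def)
    next
      case (Suc n')
      then have "m = n' + k" using \<open>n + k = Suc m\<close> by simp
      then show ?thesis
        using scale[of B "visit_dist P U m k" "t ^ n'"] Suc
        by (simp add: b_def gf_term_def[abs_def] mult_ac)
    qed
    finally show ?thesis .
  qed
  have as: "a abs_summable_on UNIV"
  proof (cases "k = 0")
    case True
    have "(\<lambda>n. norm (a n)) summable_on {0}" by simp
    then show ?thesis
      by (rule summable_on_cong_neutral[THEN iffD1, rotated -1]) (auto simp: a_def True)
  next
    case False
    then show ?thesis using As[of "k - 1"] by (simp add: a_def)
  qed
  have a_sum: "infsum a UNIV = (if k = 0 then 1 else mat_vec A (gf (k - 1)) i)"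
  proof (cases "k = 0")
    case True
    have "infsum a UNIV = infsum a {0}"
      by (rule infsum_cong_neutral) (auto simp: a_def True)
    then show ?thesis by (simp add: True a_def)
  qed (simp add: a_def[abs_def] AG)
  \<comment> \<open>Summability of \<open>b\<close> is inherited from the two other families, of
    which it is the difference.\<close>
  have b_eq: "b n = gf_term k n i - a n" for n by (simp add: summand)
  have bs: "b abs_summable_on UNIV"
    by (rule Infinite_Sum.abs_summable_on_comparison_test'
        [OF summable_on_add[OF gf_term_abs_summable[of k i] as]])
       (simp add: b_eq norm_triangle_ineq4)
  have "infsum b UNIV = t * mat_vec B (gf k) i"
    \<comment> \<open>Since \<open>b 0\<close> is 0, removing index 0 shifts the rest to the series
      for \<open>mat_vec B (gf k) i\<close>.\<close>
    unfolding infsum_nat_split[OF abs_summable_summable[OF bs]]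
    by (simp add: b_def BG infsum_cmult_right')
  moreover have "gf k i = infsum a UNIV + infsum b UNIV"
    unfolding gf_def summand
    by (rule infsum_add[OF abs_summable_summable[OF as] abs_summable_summable[OF bs]])
  ultimately show ?thesis by (simp add: a_sum)
qed

end

section \<open>Iterating the equations over \<open>k\<close>\<close>

theorem mainTheorem2:
  fixes M :: "'s::countable \<Rightarrow> 'w measure"
    and X :: "nat \<Rightarrow> 'w \<Rightarrow> 's"
    and P :: "'s \<Rightarrow> 's \<Rightarrow> real"
    and U :: "'s set"
    and A B :: "'s \<Rightarrow> 's \<Rightarrow> 'a::{real_normed_field,banach}"
    and t :: 'a
    and k :: nat
  assumes chain: "\<And>i. markov_chain (M i) X P"
    and initial: "\<And>i. \<P>(\<omega> in M i. X 0 \<omega> = i) > 0"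
    and A: "\<And>i j. A i j = (if j \<in> U then of_real (P i j) else 0)"
    and B: "\<And>i j. B i j = (if j \<notin> U then of_real (P i j) else 0)"
    and t: "norm t < 1"
  shows "visit_gf M X U t k =
    ((mat_inv (I_minus B t) \<circ> mat_vec A) ^^ k)
      (mat_inv (I_minus B t) (\<lambda>_. 1))"
proof -
  have P: "transition_matrix P" using chain by (simp add: markov_chain_def)
  have gf: "visit_gf M X U t k = gf P U t k" for k
  proof
    fix i
    \<comment> \<open>Replacing \<open>n\<close> by \<open>n + k\<close> turns the exponent
      \<open>n - k\<close> into \<open>n\<close>, which matches the indexing of
      \<open>gf_term\<close>.\<close>
    have "bij_betw (\<lambda>n. n + k) UNIV {k..}"
      by (rule bij_betwI[where g = "\<lambda>n. n - k"]) auto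
    then show "visit_gf M X U t k i = gf P U t k i"
      unfolding visit_gf_def gf_def[OF P t] gf_term_def[OF P t]
        visit_prob_eq_visit_dist[OF chain initial]
      by (subst infsum_reindex_bij_betw[symmetric]) auto
  qed
  have "gf P U t k = ((mat_inv (I_minus B t) \<circ> mat_vec A) ^^ k) (mat_inv (I_minus B t) (\<lambda>_. 1))"
  proof (induction k)
    case 0
    have "mat_inv (I_minus B t) (\<lambda>_. 1) = gf P U t 0"
      by (rule mat_inv_I_minus_eqI[OF P B t norm_gf_le[OF P t]])
         (subst gf_equation[OF P t A B], simp)
    then show ?case by simp
  next
    case (Suc k)
    have "mat_inv (I_minus B t) (mat_vec A (gf P U t k)) = gf P U t (Suc k)"
      by (rule mat_inv_I_minus_eqI[OF P B t norm_gf_le[OF P t]])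
         (subst gf_equation[OF P t A B], simp)
    then show ?case by (simp add: Suc)
  qed
  then show ?thesis by (simp add: gf)
qed

end
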